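(* Let $1<t<3/2$ and let $\mathcal D$ be a dyadic system on $\mathbb T$. Then $\mathcal M_t^{\mathcal D}:L^\infty(\mathbb D)\to L^{\frac{1}{2t-2},\infty}(\mathbb D)$ is bounded.
   Context: $\mathbb D$ is the open unit disc in $\mathbb C$, $dA$ is normalized area measure on $\mathbb D$, $|E|$ denotes the $dA$-measure of $E\subseteq\mathbb D$, and $L^p(\mathbb D)$ is taken with respect to $dA$. $\mathbb T$ is the unit circle with arc length normalized so that $|\mathbb T|=1$; $|I|$ is the normalized length of an arc $I$. A dyadic system on $\mathbb T$ is a collection of arcs $\mathcal D=\bigcup_{k\ge0}\mathcal D_k$ where each $\mathcal D_k$ consists of $2^k$ disjoint arcs of length $2^{-k}$ with union $\mathbb T$, and each arc of $\mathcal D_k$ is the union of two arcs of $\mathcal D_{k+1}$. The Carleson box of an arc $I\subseteq\mathbb T$ is $Q_I:=\{z\in\mathbb D: z/|z|\in I,\ 1-|I|\le|z|<1\}$ (the single point $z=0$ is a null set and plays no role). The dyadic hypersingular maximal operator is $$\mathcal M_t^{\mathcal D}f(z):=\sup_{I\in\mathcal D,\ z\in Q_I}\frac{1}{|Q_I|^t}\int_{Q_I}|f(w)|\,dA(w).$$ $\|f\|_{L^{q,\infty}(\mathbb D)}:=\sup_{\lambda>0}\lambda|\{z\in\mathbb D:|f(z)|>\lambda\}|^{1/q}$. *)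

theory Defs
  imports "HOL-Analysis.Analysis" "HOL-Probability.Essential_Supremum" "HOL-Library.Disjoint_Sets"
begin

definition disc_area :: "complex measure" where
  "disc_area = scale_measure (ennreal (1 / pi)) (lebesgue_on (ball 0 1))"

text \<open>Arcs may be open, closed or half-open; the whole circle is an arc.\<close>

definition is_circle_arc :: "complex set \<Rightarrow> bool" where
  "is_circle_arc I \<longleftrightarrow> (\<exists>J :: real set. is_interval J \<and> I = cis ` J)"

definition circle_length :: "complex set \<Rightarrow> real" where
  "circle_length I = measure lebesgue {s \<in> {0..<1}. cis (2 * pi * s) \<in> I}"

definition dyadic_system :: "complex set set \<Rightarrow> bool" where
  "dyadic_system \<D> \<longleftrightarrow>
     (\<exists>D :: nat \<Rightarrow> complex set set. \<D> = (\<Union>k. D k) \<and>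
       (\<forall>k. card (D k) = 2 ^ k \<and>
            (\<forall>I\<in>D k. is_circle_arc I \<and> circle_length I = 1 / 2 ^ k) \<and>
            disjoint (D k) \<and>
            \<Union> (D k) = sphere 0 1 \<and>
            (\<forall>I\<in>D k. \<exists>J\<in>D (Suc k). \<exists>J'\<in>D (Suc k). J \<noteq> J' \<and> I = J \<union> J')))"

text \<open>Since \<open>0 / 0 = 0\<close> is not on the circle, the origin belongs to no Carleson box.\<close>

definition carleson_box :: "complex set \<Rightarrow> complex set" where
  "carleson_box I =
     {z \<in> ball 0 1. z / of_real (norm z) \<in> I \<and> 1 - circle_length I \<le> norm z \<and> norm z < 1}"

text \<open>Values are taken in \<open>[0, \<infinity>]\<close>; at the origin the supremum is over the
  empty family and equals \<open>0\<close>.\<close>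

definition dyadic_maximal ::
    "real \<Rightarrow> complex set set \<Rightarrow> (complex \<Rightarrow> complex) \<Rightarrow> complex \<Rightarrow> ennreal" where
  "dyadic_maximal t \<D> f z =
     (SUP I\<in>{I \<in> \<D>. z \<in> carleson_box I}.
        (1 / ennreal (measure disc_area (carleson_box I) powr t)) *
        (\<integral>\<^sup>+w\<in>carleson_box I. ennreal (norm (f w)) \<partial>disc_area))"

definition Linf_norm :: "(complex \<Rightarrow> complex) \<Rightarrow> ennreal" where
  "Linf_norm f = esssup disc_area (\<lambda>z. ennreal (norm (f z)))"

definition Linf :: "(complex \<Rightarrow> complex) set" where
  "Linf = {f \<in> borel_measurable disc_area. Linf_norm f < \<infinity>}"

definition weak_norm :: "real \<Rightarrow> (complex \<Rightarrow> ennreal) \<Rightarrow> ennreal" where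
  "weak_norm q g =
     (SUP s\<in>{0<..}. ennreal s *
        ennreal (measure disc_area {z \<in> ball 0 1. ennreal s < g z} powr (1 / q)))"

definition weak_L :: "real \<Rightarrow> (complex \<Rightarrow> ennreal) set" where
  "weak_L q = {g \<in> borel_measurable disc_area. weak_norm q g < \<infinity>}"

end

theory Submission
  imports Defs
begin

text \<open>
  The box of a dyadic arc \<open>I\<close> of length \<open>h\<close> has width and height comparable to \<open>h\<close>, hence
  area at least a constant times \<open>h\<^sup>2\<close>, and all its points satisfy \<open>1 - \<bar>z\<bar> \<le> h\<close>. If
  \<open>N = \<parallel>f\<parallel>\<^sub>\<infinity>\<close>, then the integral of \<open>\<bar>f\<bar>\<close> over \<open>Q\<^sub>I\<close>, divided by \<open>\<bar>Q\<^sub>I\<bar>\<^sup>t\<close>, is at most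
  \<open>N \<bar>Q\<^sub>I\<bar>\<^sup>1\<^sup>-\<^sup>t\<close>. As \<open>t > 1\<close>, the exponent is negative, so the two facts combine to a bound
  that no longer mentions \<open>I\<close> (\<open>dyadic_maximal_le\<close>):
  the maximal function at \<open>z\<close> is at most \<open>N (8 / (1 - \<bar>z\<bar>))\<^sup>p\<close> with \<open>p = 2 t - 2\<close>.

  The right-hand side is radial, and it exceeds \<open>s\<close> only on the annulus
  \<open>1 - \<bar>z\<bar> < 8 (N / s)\<^sup>1\<^sup>/\<^sup>p\<close>. An annulus of width \<open>r\<close> has normalized area at most
  \<open>2 r\<close>, which gives the weak-type bound for the exponent \<open>1 / p\<close> with constant \<open>16\<^sup>p\<close>
  (\<open>weak_norm_dyadic_maximal_le\<close>).

  The lower bound on the area of a box is obtained without polar coordinates. The box contains a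
  Euclidean disc of radius \<open>h / 8\<close> (\<open>carleson_box_contains_ball\<close>), because an arc of length
  \<open>h\<close> is the image of an interval of angles at least as long as \<open>h\<close>
  (\<open>arc_contains_angles\<close>). Measurability of the maximal function holds since it is a
  supremum of countably many multiples of indicators of Borel sets.
\<close>

section \<open>Measurability of Carleson boxes\<close>

text \<open>\<^term>\<open>Arg\<close> is continuous off the closed negative axis and constant on the negative axis.\<close>

lemma borel_measurable_Arg [measurable]: "Arg \<in> borel_measurable borel"
proof -
  let ?g = "\<lambda>z. if z \<in> \<real>\<^sub>\<le>\<^sub>0 then pi else Arg z"
  let ?h = "\<lambda>z. if z \<in> {0} then 0 else ?g z"
  have "?g \<in> borel_measurable borel"
    by (rule borel_measurable_continuous_on_if)
      (auto intro: continuous_on_Arg closed_nonpos_Reals_complex)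
  then have "?h \<in> borel_measurable borel"
    by measurable
  moreover have "?h z = Arg z" for z
  proof (cases "z = 0 \<or> z \<notin> \<real>\<^sub>\<le>\<^sub>0")
    case False
    then have "Arg z = pi"
      by (metis Arg_eq_pi complex_eq_iff complex_nonpos_Reals_iff less_eq_real_def zero_complex.sel)
    then show ?thesis using False by simp
  qed (auto simp: Arg_zero)
  ultimately show ?thesis by (rule back_subst[of "\<lambda>f. f \<in> borel_measurable borel", OF _ ext])
qed

lemma cis_in_image_iff: "cis x \<in> cis ` J \<longleftrightarrow> (\<exists>n::int. x + 2 * pi * n \<in> J)"
proof
  assume "cis x \<in> cis ` J"
  then obtain y where "y \<in> J" "cis x = cis y" by auto
  then have "sin y = sin x \<and> cos y = cos x" by (simp add: complex_eq_iff)
  then show "\<exists>n::int. x + 2 * pi * n \<in> J" using \<open>y \<in> J\<close> sin_cos_eq_iff by metis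
next
  assume "\<exists>n::int. x + 2 * pi * n \<in> J"
  then obtain n :: int where n: "x + 2 * pi * n \<in> J" ..
  have "sin (x + 2 * pi * n) = sin x \<and> cos (x + 2 * pi * n) = cos x"
    using sin_cos_eq_iff by blast
  then have "cis x = cis (x + 2 * pi * n)" by (simp add: complex_eq_iff)
  then show "cis x \<in> cis ` J" using n by blast
qed

text \<open>
  A point \<open>z \<noteq> 0\<close> lies over the arc \<open>cis ` J\<close> iff one of the countably many translates of
  \<open>Arg z\<close> by multiples of \<open>2 \<pi>\<close> lies in \<open>J\<close>, and intervals are Borel.
\<close>

lemma carleson_box_borel:
  assumes "is_circle_arc I"
  shows "carleson_box I \<in> sets borel"
proof -
  obtain J :: "real set" where J: "is_interval J" "I = cis ` J"
    using assms by (auto simp: is_circle_arc_def)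
  have [measurable]: "J \<in> sets borel"
    by (rule real_interval_borel_measurable) (rule J)
  have "z / of_real (norm z) \<in> I \<longleftrightarrow> (\<exists>n::int. Arg z + 2 * pi * n \<in> J)" if "z \<noteq> 0" for z
    using that cis_in_image_iff[of "Arg z" J] J cis_Arg[of z] by (simp add: Complex.sgn_eq)
  moreover have "0 / of_real (norm (0::complex)) \<notin> I"
    using J by (auto simp: complex_eq_iff) (metis sin_zero_abs_cos_one abs_0 zero_neq_one)
  ultimately have "carleson_box I =
      {z. z \<noteq> 0 \<and> (\<exists>n::int. Arg z + 2 * pi * n \<in> J) \<and> 1 - circle_length I \<le> norm z \<and> norm z < 1}"
    unfolding carleson_box_def by (intro Collect_cong) (metis dist_0_norm mem_ball)
  also have "\<dots> \<in> sets borel" by measurable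
  finally show ?thesis .
qed

section \<open>The disc\<close>

lemma space_disc_area: "space disc_area = ball 0 1"
  by (simp add: disc_area_def space_scale_measure)

lemma sets_disc_area_iff: "A \<in> sets disc_area \<longleftrightarrow> A \<subseteq> ball 0 1 \<and> A \<in> sets lebesgue"
  by (auto simp: disc_area_def sets_restrict_space_iff)

lemma finite_measure_disc_area: "finite_measure disc_area"
proof
  show "emeasure disc_area (space disc_area) \<noteq> \<infinity>"
    unfolding space_disc_area using emeasure_bounded_finite[of "ball (0::complex) 1"]
    by (auto simp: disc_area_def emeasure_restrict_space ennreal_mult_eq_top_iff)
qed

lemma measure_disc_area:
  assumes "A \<subseteq> ball 0 1"
  shows "measure disc_area A = measure lebesgue A / pi"
  using assms by (simp add: disc_area_def measure_restrict_space)

lemma measure_disc_area_ball: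
  assumes "ball c r \<subseteq> ball (0::complex) 1" and "0 \<le> r"
  shows "measure disc_area (ball c r) = r\<^sup>2"
  using assms by (simp add: measure_disc_area content_ball unit_ball_vol_2)

text \<open>
  For \<open>r \<le> 1\<close> the area is \<open>1 - (1 - r)\<^sup>2 = 2 r - r\<^sup>2\<close>; for larger \<open>r\<close> the area of the
  whole disc suffices.
\<close>

lemma measure_annulus_le:
  assumes "0 \<le> r"
  shows "measure disc_area {z \<in> ball 0 1. 1 - norm z < r} \<le> 2 * r"
proof -
  interpret finite_measure disc_area by (rule finite_measure_disc_area)
  have B: "measure disc_area (ball 0 1) = 1"
    using measure_disc_area_ball[of 0 1] by simp
  have sub: "{z \<in> ball 0 1. 1 - norm z < r} \<subseteq> ball (0::complex) 1 - ball 0 (1 - r)"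
    by auto
  have ms: "ball c s \<in> sets disc_area" if "ball c s \<subseteq> ball 0 1" for c s
    using that by (simp add: sets_disc_area_iff)
  show ?thesis
  proof (cases "r \<le> 1")
    case True
    have b: "ball 0 (1 - r) \<subseteq> ball (0::complex) 1" using assms by auto
    have "measure disc_area {z \<in> ball 0 1. 1 - norm z < r}
        \<le> measure disc_area (ball 0 1 - ball 0 (1 - r))"
      using ms[OF b] ms[of 0 1] by (intro finite_measure_mono sub) auto
    also have "\<dots> = 1 - (1 - r)\<^sup>2"
      using True b ms[OF b] ms[of 0 1]
      by (subst finite_measure_Diff) (auto simp: B measure_disc_area_ball)
    also have "\<dots> \<le> 2 * r" by (simp add: power2_eq_square algebra_simps)
    finally show ?thesis .
  next
    case False
    have "measure disc_area {z \<in> ball 0 1. 1 - norm z < r} \<le> measure disc_area (ball 0 1)"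
      using ms[of 0 1] by (intro finite_measure_mono) auto
    then show ?thesis using False B by linarith
  qed
qed

section \<open>The area of a Carleson box\<close>

text \<open>
  Dividing the angles by \<open>2 \<pi>\<close> and translating by an integer puts \<open>{a..b}\<close> into
  \<open>{\<alpha>..\<beta>}\<close> with \<open>0 \<le> \<alpha> < 1\<close> and \<open>\<beta> < \<alpha> + 1\<close>. Only the translates by \<open>0\<close> and
  \<open>-1\<close> can then meet \<open>{0..<1}\<close>. Counting both of them in full costs a factor \<open>2\<close> over the
  sharp bound \<open>(b - a) / (2 \<pi>)\<close>.
\<close>

lemma circle_length_cis_image_le:
  assumes J: "J \<subseteq> {a..b}" and "a \<le> b" and "b - a < 2 * pi"
  shows "circle_length (cis ` J) \<le> (b - a) / pi"
proof -
  define n where "n = \<lfloor>a / (2 * pi)\<rfloor>"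
  define \<alpha> where "\<alpha> = a / (2 * pi) - n"
  define \<beta> where "\<beta> = b / (2 * pi) - n"
  have \<alpha>: "0 \<le> \<alpha>" "\<alpha> < 1" unfolding \<alpha>_def n_def by linarith+
  have \<beta>\<alpha>: "\<beta> - \<alpha> = (b - a) / (2 * pi)" by (simp add: \<alpha>_def \<beta>_def diff_divide_distrib)
  then have \<beta>: "\<alpha> \<le> \<beta>" "\<beta> < \<alpha> + 1"
  proof -
    have "0 \<le> (b - a) / (2 * pi)" "(b - a) / (2 * pi) < 1" using assms by auto
    then show "\<alpha> \<le> \<beta>" "\<beta> < \<alpha> + 1" using \<beta>\<alpha> by linarith+
  qed
  let ?S = "{s \<in> {0..<1}. cis (2 * pi * s) \<in> cis ` J}"
  have "?S \<subseteq> {\<alpha>..\<beta>} \<union> {\<alpha> - 1..\<beta> - 1}"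
  proof
    fix s assume s: "s \<in> ?S"
    then obtain m :: int where m: "2 * pi * s + 2 * pi * m \<in> J"
      using cis_in_image_iff by blast
    then have "a \<le> 2 * pi * (s + m)" "2 * pi * (s + m) \<le> b"
      using J by (auto simp: algebra_simps)
    then have "a / (2 * pi) \<le> s + m" "s + m \<le> b / (2 * pi)"
      by (simp_all add: field_simps)
    then have k: "\<alpha> \<le> s + (m - n)" "s + (m - n) \<le> \<beta>"
      by (simp_all add: \<alpha>_def \<beta>_def)
    then have "-1 < real_of_int (m - n)" "real_of_int (m - n) < 2" using s \<alpha> \<beta> by auto
    then have "m - n = 0 \<or> m - n = 1" by linarith
    then have "real_of_int (m - n) = 0 \<or> real_of_int (m - n) = 1" by auto
    then show "s \<in> {\<alpha>..\<beta>} \<union> {\<alpha> - 1..\<beta> - 1}" using k by auto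
  qed
  moreover have "0 \<le> (b - a) / pi" using assms by simp
  moreover have "measure lebesgue ({\<alpha>..\<beta>} \<union> {\<alpha> - 1..\<beta> - 1}) \<le> (b - a) / pi"
  proof -
    have "measure lebesgue ({\<alpha>..\<beta>} \<union> {\<alpha> - 1..\<beta> - 1}) \<le> (\<beta> - \<alpha>) + (\<beta> - \<alpha>)"
      using \<beta> by (intro order_trans[OF measure_Un_le]) auto
    also have "\<dots> = (b - a) / pi"
      unfolding \<beta>\<alpha> by (simp add: field_simps)
    finally show ?thesis .
  qed
  moreover have "measure lebesgue ?S \<le> measure lebesgue ({\<alpha>..\<beta>} \<union> {\<alpha> - 1..\<beta> - 1})"
    if "?S \<in> sets lebesgue"
    using calculation(1) that by (rule measure_mono_fmeasurable) (auto intro: fmeasurable.Un)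
  ultimately have "measure lebesgue ?S \<le> (b - a) / pi"
    by (cases "?S \<in> sets lebesgue") (fastforce simp: measure_notin_sets)+
  then show ?thesis by (simp only: circle_length_def)
qed

text \<open>
  If any two angles of the arc differed by less than its length \<open>h\<close>, all of them would lie
  within \<open>h\<close> of a fixed one, and the previous bound would give \<open>h \<le> 2 h / \<pi> < h\<close>.
\<close>

lemma arc_contains_angles:
  assumes "is_circle_arc I" and "0 < circle_length I" and "circle_length I \<le> 1"
  obtains m where "\<And>x. \<bar>x - m\<bar> \<le> circle_length I / 2 \<Longrightarrow> cis x \<in> I"
proof -
  define h where "h = circle_length I"
  obtain J :: "real set" where J: "is_interval J" "I = cis ` J"
    using assms by (auto simp: is_circle_arc_def)
  have "\<exists>x\<in>J. \<exists>y\<in>J. h \<le> y - x"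
  proof (rule ccontr)
    assume neg: "\<not> ?thesis"
    have "J \<noteq> {}" using assms J by (auto simp: circle_length_def)
    then obtain u where u: "u \<in> J" by auto
    have "J \<subseteq> {u - h..u + h}"
    proof
      fix x assume "x \<in> J"
      then have "\<not> h \<le> x - u" "\<not> h \<le> u - x" using neg u by blast+
      then show "x \<in> {u - h..u + h}" by auto
    qed
    moreover have "u + h - (u - h) < 2 * pi"
      using assms pi_gt3 by (simp add: h_def)
    ultimately have "circle_length (cis ` J) \<le> (u + h - (u - h)) / pi"
      using assms by (intro circle_length_cis_image_le) (auto simp: h_def)
    then have "h \<le> 2 * h / pi" using J by (simp add: h_def)
    then have "h * pi \<le> h * 2" by (simp add: field_simps)
    then show False using assms pi_gt3 by (simp add: h_def)
  qed
  then obtain x y where xy: "x \<in> J" "y \<in> J" "h \<le> y - x" by blast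
  show thesis
  proof (rule that[of "(x + y) / 2"])
    fix w assume "\<bar>w - (x + y) / 2\<bar> \<le> circle_length I / 2"
    then have "x \<le> w" "w \<le> y" using xy by (auto simp: h_def abs_le_iff field_simps)
    then have "w \<in> J" using J(1) xy by (meson mem_is_interval_1_I)
    then show "cis w \<in> I" using J by simp
  qed
qed

text \<open>
  The disc is centred at half the height of the box above the middle of the arc. At modulus at
  least \<open>1 / 2\<close>, a displacement of less than \<open>h / 8\<close> multiplies the centre by \<open>1 + u\<close> with
  \<open>\<bar>u\<bar> < h / 4\<close>, so it turns the argument by at most \<open>\<bar>Ln (1 + u)\<bar> \<le> 2 \<bar>u\<bar> < h / 2\<close>.
\<close>

lemma carleson_box_contains_ball:
  assumes "is_circle_arc I" and "0 < circle_length I" and "circle_length I \<le> 1"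
  obtains c where "ball c (circle_length I / 8) \<subseteq> carleson_box I"
proof -
  define h where "h = circle_length I"
  have h: "0 < h" "h \<le> 1" using assms by (auto simp: h_def)
  obtain m where m: "\<And>x. \<bar>x - m\<bar> \<le> h / 2 \<Longrightarrow> cis x \<in> I"
    using arc_contains_angles[OF assms] unfolding h_def by blast
  define c where "c = of_real (1 - h / 2) * cis m"
  have c: "norm c = 1 - h / 2" using h by (simp add: c_def norm_mult del: of_real_diff)
  have "ball c (h / 8) \<subseteq> carleson_box I"
  proof
    fix z assume "z \<in> ball c (h / 8)"
    then have d: "norm (z - c) < h / 8" by (simp add: dist_norm norm_minus_commute)
    have nz: "norm z < 1 - h / 4" "1 - h \<le> norm z"
      using norm_triangle_ineq2[of z c] norm_triangle_ineq2[of c z] d c h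
      by (auto simp: norm_minus_commute)
    define u where "u = (z - c) / c"
    have c0: "c \<noteq> 0" using c h by auto
    have "norm u * norm c < h / 8"
      using d c0 by (simp add: u_def norm_divide)
    moreover have "norm u * (1 / 2) \<le> norm u * norm c"
      using c h by (intro mult_left_mono) auto
    ultimately have u: "norm u < h / 4" by simp
    then have u2: "norm u < 1 / 2" using h by simp
    have u1: "1 + u \<noteq> 0"
    proof
      assume "1 + u = 0"
      then have "u = -1" by (simp add: add_eq_0_iff)
      then show False using u2 by simp
    qed
    have "\<bar>Arg (1 + u)\<bar> \<le> norm (Ln (1 + u))"
      using u1 by (simp add: Arg_eq_Im_Ln abs_Im_le_cmod)
    also have "\<dots> \<le> 2 * norm u" by (rule norm_Ln_le[OF u2])
    finally have "cis (m + Arg (1 + u)) \<in> I" using u by (intro m) simp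
    moreover have zc: "z = c * (1 + u)" using c0 by (simp add: u_def field_simps)
    moreover have "sgn c = cis m"
      using h c by (simp add: c_def sgn_mult sgn_of_real del: of_real_diff)
    ultimately have "sgn z \<in> I"
      using cis_Arg[OF u1] by (simp add: sgn_mult flip: cis_mult)
    then show "z \<in> carleson_box I"
      using nz h by (auto simp: carleson_box_def Complex.sgn_eq h_def)
  qed
  then show thesis using that by (simp add: h_def)
qed

lemma measure_carleson_box_ge:
  assumes "is_circle_arc I" and "0 < circle_length I" and "circle_length I \<le> 1"
  shows "(circle_length I / 8)\<^sup>2 \<le> measure disc_area (carleson_box I)"
proof -
  interpret finite_measure disc_area by (rule finite_measure_disc_area)
  obtain c where c: "ball c (circle_length I / 8) \<subseteq> carleson_box I"
    using carleson_box_contains_ball[OF assms] by blast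
  have Q: "carleson_box I \<subseteq> ball 0 1" by (auto simp: carleson_box_def)
  have "carleson_box I \<in> sets disc_area"
    using Q carleson_box_borel[OF assms(1)] by (simp add: sets_disc_area_iff)
  then have "measure disc_area (ball c (circle_length I / 8)) \<le> measure disc_area (carleson_box I)"
    by (rule finite_measure_mono[OF c])
  then show ?thesis
    using measure_disc_area_ball[OF order_trans[OF c Q]] assms(2) by simp
qed

section \<open>The maximal operator\<close>

lemma dyadic_system_levels:
  assumes "dyadic_system \<D>"
  obtains D :: "nat \<Rightarrow> complex set set" where "\<D> = (\<Union>k. D k)" and "\<And>k. finite (D k)"
    and "\<And>k I. I \<in> D k \<Longrightarrow> is_circle_arc I \<and> circle_length I = 1 / 2 ^ k"
proof -
  from assms obtain D :: "nat \<Rightarrow> complex set set" where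
    D: "\<D> = (\<Union>k. D k)" and *: "\<forall>k. card (D k) = 2 ^ k \<and>
            (\<forall>I\<in>D k. is_circle_arc I \<and> circle_length I = 1 / 2 ^ k) \<and>
            disjoint (D k) \<and>
            \<Union> (D k) = sphere 0 1 \<and>
            (\<forall>I\<in>D k. \<exists>J\<in>D (Suc k). \<exists>J'\<in>D (Suc k). J \<noteq> J' \<and> I = J \<union> J')"
    unfolding dyadic_system_def by (elim exE conjE)
  have card: "card (D k) = 2 ^ k" for k
    using spec[OF *, of k] by (rule conjunct1)
  have arc: "\<forall>I\<in>D k. is_circle_arc I \<and> circle_length I = 1 / 2 ^ k" for k
    using spec[OF *, of k] by (elim conjE)
  show thesis
  proof (rule that[OF D])
    show "finite (D k)" for k
      by (rule card_ge_0_finite) (simp add: card)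
    show "is_circle_arc I \<and> circle_length I = 1 / 2 ^ k" if "I \<in> D k" for k I
      using arc[of k] that by (rule bspec)
  qed
qed

lemma dyadic_system_countable:
  assumes "dyadic_system \<D>"
  shows "countable \<D>"
proof -
  obtain D :: "nat \<Rightarrow> complex set set" where "\<D> = (\<Union>k. D k)" "\<And>k. finite (D k)"
    using dyadic_system_levels[OF assms] by metis
  then show ?thesis by (simp add: countable_finite)
qed

lemma dyadic_system_arc:
  assumes "dyadic_system \<D>" and "I \<in> \<D>"
  shows "is_circle_arc I" and "0 < circle_length I" and "circle_length I \<le> 1"
proof -
  obtain k :: nat where "is_circle_arc I" "circle_length I = 1 / 2 ^ k"
    using dyadic_system_levels[OF assms(1)] assms(2) by (metis UN_E)
  then show "is_circle_arc I" "0 < circle_length I" "circle_length I \<le> 1"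
    by simp_all
qed

text \<open>
  The supremum over the arcs whose box contains \<open>z\<close> becomes a supremum over an index set that
  does not depend on \<open>z\<close> once each term is multiplied by the indicator of its box. The two
  suprema agree even when no box contains \<open>z\<close>, because the empty supremum is \<open>0\<close>.
\<close>

lemma dyadic_maximal_measurable:
  assumes "dyadic_system \<D>"
  shows "dyadic_maximal t \<D> f \<in> borel_measurable disc_area"
proof -
  let ?a = "\<lambda>I. (1 / ennreal (measure disc_area (carleson_box I) powr t)) *
        (\<integral>\<^sup>+w\<in>carleson_box I. ennreal (norm (f w)) \<partial>disc_area)"
  have "dyadic_maximal t \<D> f = (\<lambda>z. SUP I\<in>\<D>. ?a I * indicator (carleson_box I) z)"
  proof
    fix z
    show "dyadic_maximal t \<D> f z = (SUP I\<in>\<D>. ?a I * indicator (carleson_box I) z)"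
      unfolding dyadic_maximal_def
    proof (intro antisym SUP_least)
      fix I assume "I \<in> {I \<in> \<D>. z \<in> carleson_box I}"
      then show "?a I \<le> (SUP I\<in>\<D>. ?a I * indicator (carleson_box I) z)"
        by (intro SUP_upper2[of I]) auto
    next
      fix I assume "I \<in> \<D>"
      then show "?a I * indicator (carleson_box I) z \<le> (SUP I\<in>{I \<in> \<D>. z \<in> carleson_box I}. ?a I)"
        by (cases "z \<in> carleson_box I") (auto intro: SUP_upper2)
    qed
  qed
  moreover have "carleson_box I \<in> sets disc_area" if "I \<in> \<D>" for I
    using carleson_box_borel[OF dyadic_system_arc(1)[OF assms that]]
    by (auto simp: sets_disc_area_iff carleson_box_def)
  ultimately show ?thesis
    by (auto intro!: borel_measurable_SUP dyadic_system_countable[OF assms]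
        borel_measurable_times_ennreal borel_measurable_indicator)
qed

text \<open>
  The left-hand side is at most \<open>N m\<^sup>1\<^sup>-\<^sup>t\<close>, where \<open>m\<close> is the area of the box, and
  \<open>m \<ge> (h / 8)\<^sup>2 \<ge> ((1 - \<bar>z\<bar>) / 8)\<^sup>2\<close> by the position of \<open>z\<close> in the box.
\<close>

lemma box_average_le:
  assumes t: "1 < t" and I: "is_circle_arc I" "0 < circle_length I" "circle_length I \<le> 1"
    and z: "z \<in> carleson_box I" and N: "Linf_norm f = ennreal N" "0 \<le> N"
  shows "(1 / ennreal (measure disc_area (carleson_box I) powr t)) *
        (\<integral>\<^sup>+w\<in>carleson_box I. ennreal (norm (f w)) \<partial>disc_area)
      \<le> ennreal (N * (8 / (1 - norm z)) powr (2 * t - 2))"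
proof -
  interpret finite_measure disc_area by (rule finite_measure_disc_area)
  define m where "m = measure disc_area (carleson_box I)"
  have z1: "0 < 1 - norm z" "1 - norm z \<le> circle_length I"
    using z by (auto simp: carleson_box_def)
  have "((1 - norm z) / 8)\<^sup>2 \<le> (circle_length I / 8)\<^sup>2"
    using z1 by (intro power_mono) auto
  also have "\<dots> \<le> m" unfolding m_def by (rule measure_carleson_box_ge[OF I])
  finally have m: "((1 - norm z) / 8)\<^sup>2 \<le> m" .
  have "0 < ((1 - norm z) / 8)\<^sup>2" using z1 by simp
  then have m0: "0 < m" using m by linarith
  have Q: "carleson_box I \<in> sets disc_area"
    using carleson_box_borel[OF I(1)] by (auto simp: sets_disc_area_iff carleson_box_def)
  have "(\<integral>\<^sup>+w\<in>carleson_box I. ennreal (norm (f w)) \<partial>disc_area)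
      \<le> (\<integral>\<^sup>+w\<in>carleson_box I. ennreal N \<partial>disc_area)"
    using esssup_AE[of "\<lambda>w. ennreal (norm (f w))" disc_area] N(1)
    by (intro nn_integral_mono_AE) (auto simp: Linf_norm_def elim!: eventually_mono intro!: mult_right_mono)
  also have "\<dots> = ennreal (N * m)"
    using Q N(2) by (simp add: nn_integral_cmult_indicator emeasure_eq_measure m_def ennreal_mult)
  finally have "(1 / ennreal (m powr t)) * (\<integral>\<^sup>+w\<in>carleson_box I. ennreal (norm (f w)) \<partial>disc_area)
      \<le> (1 / ennreal (m powr t)) * ennreal (N * m)"
    by (rule mult_left_mono) simp
  also have "\<dots> = ennreal (N * m powr (1 - t))"
  proof -
    have "1 / ennreal (m powr t) = ennreal (1 / m powr t)"
      using m0 by (metis divide_ennreal ennreal_1 powr_gt_zero zero_le_one less_irrefl)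
    moreover have "1 / m powr t * (N * m) = N * m powr (1 - t)"
      using m0 by (simp add: powr_diff)
    ultimately show ?thesis using m0 N(2) by (simp flip: ennreal_mult)
  qed
  also have "\<dots> \<le> ennreal (N * (8 / (1 - norm z)) powr (2 * t - 2))"
  proof -
    have "m powr (1 - t) \<le> (((1 - norm z) / 8)\<^sup>2) powr (1 - t)"
      using t m z1 by (intro powr_mono2') auto
    also have "\<dots> = ((1 - norm z) / 8) powr (- (2 * t - 2))"
      using z1 by (simp add: powr_powr flip: powr_numeral)
    also have "\<dots> = (8 / (1 - norm z)) powr (2 * t - 2)"
      unfolding powr_minus_divide using z1 by (simp add: powr_divide)
    finally show ?thesis using N(2) by (intro ennreal_leI mult_left_mono)
  qed
  finally show ?thesis by (simp add: m_def)
qed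

lemma dyadic_maximal_le:
  assumes "1 < t" and "dyadic_system \<D>" and "Linf_norm f = ennreal N" and "0 \<le> N"
  shows "dyadic_maximal t \<D> f z \<le> ennreal (N * (8 / (1 - norm z)) powr (2 * t - 2))"
  unfolding dyadic_maximal_def
  using assms dyadic_system_arc by (intro SUP_least box_average_le) auto

text \<open>
  The level set lies in an annulus of width \<open>r = 8 (N / s)\<^sup>1\<^sup>/\<^sup>p\<close>, of area at most \<open>2 r\<close>,
  and \<open>s (2 r)\<^sup>p = 16\<^sup>p N\<close> for every \<open>s\<close>.
\<close>

lemma weak_norm_dyadic_maximal_le:
  assumes t: "1 < t" and D: "dyadic_system \<D>" and N: "Linf_norm f = ennreal N" "0 \<le> N"
  shows "weak_norm (1 / (2 * t - 2)) (dyadic_maximal t \<D> f) \<le> ennreal (16 powr (2 * t - 2) * N)"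
  unfolding weak_norm_def
proof (intro SUP_least)
  interpret finite_measure disc_area by (rule finite_measure_disc_area)
  fix s :: real assume "s \<in> {0<..}"
  then have s: "0 < s" by simp
  define p where "p = 2 * t - 2"
  have p: "0 < p" using t by (simp add: p_def)
  define r where "r = 8 * (N / s) powr (1 / p)"
  have r: "0 \<le> r" by (simp add: r_def)
  let ?E = "{z \<in> ball 0 1. ennreal s < dyadic_maximal t \<D> f z}"
  have "?E \<subseteq> {z \<in> ball 0 1. 1 - norm z < r}"
  proof
    fix z assume z: "z \<in> ?E"
    then have d: "0 < 1 - norm z" by simp
    have "ennreal s < ennreal (N * (8 / (1 - norm z)) powr p)"
      using z dyadic_maximal_le[OF t D N] unfolding p_def by (blast intro: less_le_trans)
    then have "s < N * (8 / (1 - norm z)) powr p"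
      using s by (simp add: ennreal_less_iff)
    then have "((1 - norm z) / 8) powr p < N / s"
      using s d by (simp add: powr_divide field_simps)
    then have "(((1 - norm z) / 8) powr p) powr (1 / p) < (N / s) powr (1 / p)"
      using p by (intro powr_less_mono2) auto
    then have "(1 - norm z) / 8 < (N / s) powr (1 / p)"
      using p d by (simp add: powr_powr)
    then show "z \<in> {z \<in> ball 0 1. 1 - norm z < r}" using z by (simp add: r_def)
  qed
  moreover have "{z \<in> ball 0 1. 1 - norm z < r} \<in> sets disc_area"
  proof -
    have "{z \<in> ball 0 1. 1 - norm z < r} \<in> sets (borel :: complex measure)" by measurable
    then show ?thesis by (auto simp: sets_disc_area_iff)
  qed
  ultimately have "measure disc_area ?E \<le> measure disc_area {z \<in> ball 0 1. 1 - norm z < r}"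
    by (rule finite_measure_mono)
  also have "\<dots> \<le> 2 * r" by (rule measure_annulus_le[OF r])
  finally have "measure disc_area ?E powr p \<le> (2 * r) powr p"
    using p by (intro powr_mono2) auto
  also have "\<dots> = 16 powr p * (N / s)"
    using p s N(2) by (simp add: r_def powr_mult powr_powr flip: mult.assoc)
  finally have "s * measure disc_area ?E powr p \<le> 16 powr p * N"
    using s by (simp add: field_simps)
  then show "ennreal s * ennreal (measure disc_area ?E powr (1 / (1 / (2 * t - 2))))
      \<le> ennreal (16 powr (2 * t - 2) * N)"
    using s by (simp add: p_def ennreal_leI flip: ennreal_mult)
qed

theorem lemma3p4:
  fixes t :: real and \<D> :: "complex set set"
  assumes "1 < t" and "t < 3 / 2"
    and "dyadic_system \<D>"
  shows "(\<forall>f\<in>Linf. dyadic_maximal t \<D> f \<in> weak_L (1 / (2 * t - 2))) \<and>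
    (\<exists>C\<ge>0::real. \<forall>f\<in>Linf.
       weak_norm (1 / (2 * t - 2)) (dyadic_maximal t \<D> f) \<le> ennreal C * Linf_norm f)"
proof -
  have bound: "weak_norm (1 / (2 * t - 2)) (dyadic_maximal t \<D> f)
      \<le> ennreal (16 powr (2 * t - 2)) * Linf_norm f"
    and fin: "Linf_norm f < \<infinity>" if "f \<in> Linf" for f
  proof -
    show "Linf_norm f < \<infinity>" using that by (simp add: Linf_def)
    then obtain N where N: "Linf_norm f = ennreal N" "0 \<le> N"
      by (cases "Linf_norm f") auto
    then show "weak_norm (1 / (2 * t - 2)) (dyadic_maximal t \<D> f)
      \<le> ennreal (16 powr (2 * t - 2)) * Linf_norm f"
      using weak_norm_dyadic_maximal_le[OF assms(1,3) N] by (simp add: ennreal_mult)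
  qed
  have "dyadic_maximal t \<D> f \<in> weak_L (1 / (2 * t - 2))" if "f \<in> Linf" for f
  proof -
    have "ennreal (16 powr (2 * t - 2)) * Linf_norm f < \<infinity>"
      using fin[OF that] by (simp add: ennreal_mult_less_top)
    then have "weak_norm (1 / (2 * t - 2)) (dyadic_maximal t \<D> f) < \<infinity>"
      using bound[OF that] by (rule le_less_trans[rotated])
    then show ?thesis
      using dyadic_maximal_measurable[OF assms(3)] by (simp add: weak_L_def)
  qed
  moreover have "0 \<le> (16::real) powr (2 * t - 2)" by simp
  ultimately show ?thesis using bound by blast
qed

end
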